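(* Let $\beta$ be a Pisot number of degree $d\ge2$ with minimal polynomial $x^d-a_{d-1}x^{d-1}-\cdots-a_1x-a_0$. Suppose that (i) $\tau^{-1}(P_\beta)\subset P_\beta$, and (ii) $([-\delta,\delta]\cap\mathbb{Z})^{d-1}\cap V_\beta\subset F_\beta$, where $\delta=\max\{|l_j|:(l_1,\dots,l_{d-1})\in P_\beta,\ 1\le j\le d-1\}$. Then $\beta$ has property (F$_1$).
   Context: A Pisot number is a real algebraic integer $\beta>1$ whose other conjugates have modulus $<1$. Let $\mathbf r=(r_1,\dots,r_{d-1})$, $r_j=\sum_{i=1}^{j}a_{j-i}\beta^{-i}$; $\lambda(\mathbf l)=\mathbf r\cdot\mathbf l$ for $\mathbf l\in\mathbb{Z}^{d-1}$; $\tau(l_1,\dots,l_{d-1})=(l_2,\dots,l_{d-1},-\lfloor\lambda(\mathbf l)\rfloor)$ and $\tau^*(\mathbf l)=-\tau(-\mathbf l)$. $\mathbf l_I=(0,\dots,0,1)$. $F_\beta=\{\mathbf l:\tau^k(\mathbf l)=\mathbf 0\text{ for some }k\ge0\}$. $V_\beta=\{-\sum_{n=1}^{r}\omega_n\tau^{n-1}(\mathbf l_I): r\in\mathbb{N},\omega_n\in\mathbb{N}_0\}$. $Q_\beta$ is the set of $\mathbf l\in\mathbb{Z}^{d-1}$ for which there is a finite sequence $\mathbf l_1=\mathbf l_I,\mathbf l_2,\dots,\mathbf l_N=\mathbf l$ with $\mathbf l_{n+1}\in\{\tau(\mathbf l_n),\tau^*(\mathbf l_n)\}$ for all $n$. $P_\beta=\{\mathbf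 l\in Q_\beta\setminus\{\mathbf 0\}:\tau^N(\mathbf l)=\mathbf l\text{ for some }N\in\mathbb{N}\}$. Property (F$_1$): every $N\in\mathbb{N}_0$ has a finite beta-expansion, i.e. with $T(x)=\beta x-\lfloor\beta x\rfloor$, $d_\beta(x)=c_1c_2\cdots$, $c_n=\lfloor\beta T^{n-1}(x)\rfloor$, and $L(x)=\min\{n\in\mathbb{N}_0:x\beta^{-n}<1\}$, the sequence $d_\beta(\beta^{-L(N)}N)$ has finitely many nonzero digits. *)

theory Defs
  imports
    Complex_Main
    "HOL-Computational_Algebra.Polynomial"
    "HOL-Library.Function_Algebras"
begin

definition is_minimal_polynomial :: "'a::field_char_0 \<Rightarrow> rat poly \<Rightarrow> bool" where
  "is_minimal_polynomial x p \<longleftrightarrow>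
     lead_coeff p = 1 \<and> poly (map_poly of_rat p) x = 0 \<and>
     (\<forall>q. q \<noteq> 0 \<and> poly (map_poly of_rat q) x = 0 \<longrightarrow> degree p \<le> degree q)"

definition conjugates :: "real \<Rightarrow> complex set" where
  "conjugates x = {z. \<exists>p. is_minimal_polynomial x p \<and> poly (map_poly of_rat p) z = 0}"

definition pisot :: "real \<Rightarrow> bool" where
  "pisot \<beta> \<longleftrightarrow>
     algebraic_int \<beta> \<and> \<beta> > 1 \<and> (\<forall>z \<in> conjugates \<beta> - {complex_of_real \<beta>}. cmod z < 1)"

text \<open>A vector $(l_1, \ldots, l_{d-1})$ is encoded as a function on the naturals that vanishes
  outside the index range \<open>{1..d-1}\<close>, so that equality, zero, negation and sums are those of
  functions.\<close>

definition int_vecs :: "nat \<Rightarrow> (nat \<Rightarrow> int) set" where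
  "int_vecs d = {l. \<forall>j. j \<notin> {1..d-1} \<longrightarrow> l j = 0}"

definition r_coeff :: "real \<Rightarrow> (nat \<Rightarrow> int) \<Rightarrow> nat \<Rightarrow> real" where
  "r_coeff \<beta> a j = (\<Sum>i=1..j. of_int (a (j - i)) / \<beta> ^ i)"

definition lam :: "real \<Rightarrow> nat \<Rightarrow> (nat \<Rightarrow> int) \<Rightarrow> (nat \<Rightarrow> int) \<Rightarrow> real" where
  "lam \<beta> d a l = (\<Sum>j=1..d-1. r_coeff \<beta> a j * of_int (l j))"

definition tau :: "real \<Rightarrow> nat \<Rightarrow> (nat \<Rightarrow> int) \<Rightarrow> (nat \<Rightarrow> int) \<Rightarrow> (nat \<Rightarrow> int)" where
  "tau \<beta> d a l =
     (\<lambda>j. if 1 \<le> j \<and> j < d - 1 then l (j + 1)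
          else if j = d - 1 then - \<lfloor>lam \<beta> d a l\<rfloor>
          else 0)"

definition tau_star :: "real \<Rightarrow> nat \<Rightarrow> (nat \<Rightarrow> int) \<Rightarrow> (nat \<Rightarrow> int) \<Rightarrow> (nat \<Rightarrow> int)" where
  "tau_star \<beta> d a l = - tau \<beta> d a (- l)"

definition l_I :: "nat \<Rightarrow> nat \<Rightarrow> int" where
  "l_I d = (\<lambda>j. if j = d - 1 then 1 else 0)"

definition F_set :: "real \<Rightarrow> nat \<Rightarrow> (nat \<Rightarrow> int) \<Rightarrow> (nat \<Rightarrow> int) set" where
  "F_set \<beta> d a = {l \<in> int_vecs d. \<exists>k. (tau \<beta> d a ^^ k) l = 0}"

definition V_set :: "real \<Rightarrow> nat \<Rightarrow> (nat \<Rightarrow> int) \<Rightarrow> (nat \<Rightarrow> int) set" where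
  "V_set \<beta> d a =
     {- (\<Sum>n=1..r. (\<lambda>j. int (\<omega> n) * (tau \<beta> d a ^^ (n - 1)) (l_I d) j)) |
       (r::nat) (\<omega> :: nat \<Rightarrow> nat). r \<ge> 1}"

definition Q_set :: "real \<Rightarrow> nat \<Rightarrow> (nat \<Rightarrow> int) \<Rightarrow> (nat \<Rightarrow> int) set" where
  "Q_set \<beta> d a =
     {l \<in> int_vecs d. \<exists>(N::nat) (s :: nat \<Rightarrow> nat \<Rightarrow> int).
        N \<ge> 1 \<and> s 1 = l_I d \<and> s N = l \<and>
        (\<forall>n. 1 \<le> n \<and> n < N \<longrightarrow> s (n + 1) \<in> {tau \<beta> d a (s n), tau_star \<beta> d a (s n)})}"

definition P_set :: "real \<Rightarrow> nat \<Rightarrow> (nat \<Rightarrow> int) \<Rightarrow> (nat \<Rightarrow> int) set" where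
  "P_set \<beta> d a = {l \<in> Q_set \<beta> d a - {0}. \<exists>N\<ge>1. (tau \<beta> d a ^^ N) l = l}"

text \<open>All entries are nonnegative, so inserting 0 does not change the maximum; it only fixes the
  convention that the maximum is 0 when \<open>P_set\<close> is empty.\<close>

definition delta :: "real \<Rightarrow> nat \<Rightarrow> (nat \<Rightarrow> int) \<Rightarrow> int" where
  "delta \<beta> d a = Max (insert 0 {\<bar>l j\<bar> | l j. l \<in> P_set \<beta> d a \<and> j \<in> {1..d-1}})"

definition beta_T :: "real \<Rightarrow> real \<Rightarrow> real" where
  "beta_T \<beta> x = \<beta> * x - of_int \<lfloor>\<beta> * x\<rfloor>"

text \<open>Digits are indexed from \<open>n = 1\<close>.\<close>

definition beta_digit :: "real \<Rightarrow> real \<Rightarrow> nat \<Rightarrow> int" where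
  "beta_digit \<beta> x n = \<lfloor>\<beta> * (beta_T \<beta> ^^ (n - 1)) x\<rfloor>"

definition beta_L :: "real \<Rightarrow> real \<Rightarrow> nat" where
  "beta_L \<beta> x = (LEAST n. x / \<beta> ^ n < 1)"

definition finite_beta_expansion :: "real \<Rightarrow> real \<Rightarrow> bool" where
  "finite_beta_expansion \<beta> x \<longleftrightarrow>
     finite {n. n \<ge> 1 \<and> beta_digit \<beta> (x / \<beta> ^ beta_L \<beta> x) n \<noteq> 0}"

definition property_F1 :: "real \<Rightarrow> bool" where
  "property_F1 \<beta> \<longleftrightarrow> (\<forall>N::nat. finite_beta_expansion \<beta> (real N))"

end

theory Submission
  imports Defs "HOL-Computational_Algebra.Fundamental_Theorem_Algebra"
begin

text \<open>The map \<open>\<tau>\<close> on integer vectors is conjugate to \<open>T\<close> on the fractional parts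
  \<open>frac (\<lambda> l)\<close>, and for a natural number \<open>N\<close> the fractional part \<open>T\<^sup>L (N / \<beta>\<^sup>L)\<close> of its
  beta-expansion is \<open>frac (\<lambda> v)\<close> for some \<open>v \<in> V\<close>; so it suffices to show \<open>V \<subseteq> F\<close>.
  The elements of \<open>V\<close> arise from \<open>0\<close> by repeatedly subtracting an element \<open>w\<close> of the
  \<open>\<tau>\<close>-orbit of \<open>l\<^sub>I\<close>. If \<open>v \<in> F\<close>, then the orbit of \<open>v - w\<close> is eventually a path in \<open>- Q\<close>, which
  is finite because all other conjugates of \<open>\<beta>\<close> lie in the open unit disk; hence this orbit ends in a
  \<open>\<tau>\<close>-periodic vector \<open>u \<in> - Q\<close>. If \<open>\<tau>\<close> maps a nonzero element of \<open>Q\<close> to \<open>0\<close>, then \<open>- Q = Q\<close>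
  and \<open>u\<close> is in \<open>P\<close> or zero; otherwise all nonzero elements of \<open>Q\<close> turn out to be positive multiples
  of \<open>l\<^sub>I\<close> in \<open>P\<close>, so that \<open>u\<close> is in \<open>V\<close> and in the box of hypothesis (ii). If \<open>u \<in> P\<close>, hypothesis (i)
  takes us back to \<open>v - w \<in> P\<close>, which again is in the box.\<close>

section \<open>Bounded solutions of linear recurrences, and eventual periodicity\<close>

text \<open>Induction on the degree: for a root \<open>z\<close> of \<open>h\<close>, the
  differences \<open>s (Suc i) - z * s i\<close> satisfy the recurrence of \<open>h\<close> divided
  by X - \<open>z\<close>, and since \<open>norm z < 1\<close> a bound on them yields one on
  \<open>s\<close>. \<open>C\<close> depends on \<open>h\<close>, \<open>M\<close> and
  \<open>B\<close> but not on \<open>s\<close>, which is what makes a whole family of sequences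
  uniformly bounded.\<close>

lemma linear_recurrence_bounded:
  fixes h :: "complex poly"
  assumes "h \<noteq> 0" "\<And>z. poly h z = 0 \<Longrightarrow> norm z < 1"
  shows "\<exists>C. \<forall>s. (\<forall>i<degree h. norm (s i) \<le> M) \<longrightarrow>
           (\<forall>k. norm (\<Sum>i\<le>degree h. coeff h i * s (k + i)) \<le> B) \<longrightarrow> (\<forall>k. norm (s k) \<le> C)"
  using assms
proof (induction "degree h" arbitrary: h M)
  case 0
  then obtain c where h: "h = [:c:]" "c \<noteq> 0"
    by (metis degree_eq_zeroE pCons_0_0)
  have "norm (s k) \<le> B / norm c" if "\<forall>k. norm (\<Sum>i\<le>degree h. coeff h i * s (k + i)) \<le> B" for s k
    using that[rule_format, of k] h by (simp add: norm_mult field_simps)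
  then show ?case by blast
next
  case (Suc n)
  then have "\<not> constant (poly h)"
    by (metis constant_degree nat.distinct(1))
  then obtain z where z: "poly h z = 0"
    using fundamental_theorem_of_algebra by blast
  then have z1: "norm z < 1"
    using Suc.prems by blast
  obtain g where g: "h = [:- z, 1:] * g"
    using z by (metis poly_eq_0_iff_dvd dvdE)
  have g0: "g \<noteq> 0"
    using Suc.prems g by auto
  then have dh: "degree h = Suc (degree g)"
    unfolding g by (subst degree_mult_eq) auto
  then have dg: "n = degree g"
    using Suc.hyps by simp
  have groots: "norm w < 1" if "poly g w = 0" for w
    using Suc.prems(2)[of w] that g by simp
  obtain C where C: "\<And>t. (\<forall>i<degree g. norm (t i) \<le> (1 + norm z) * M) \<Longrightarrow>
           (\<forall>k. norm (\<Sum>i\<le>degree g. coeff g i * t (k + i)) \<le> B) \<Longrightarrow> (\<forall>k. norm (t k) \<le> C)"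
    using Suc.hyps(1)[OF dg g0 groots, of "(1 + norm z) * M"] by blast
  \<comment> \<open>\<open>?D\<close> dominates the initial value and survives one step of
    \<open>s (Suc k) = z * s k + t k\<close>, because
    \<open>norm z * ?D + C \<le> ?D\<close>.\<close>
  let ?D = "max M (C / (1 - norm z))"
  have "norm (s k) \<le> ?D" if s: "\<forall>i<degree h. norm (s i) \<le> M"
    "\<forall>k. norm (\<Sum>i\<le>degree h. coeff h i * s (k + i)) \<le> B" for s k
  proof -
    define t where "t i = s (Suc i) - z * s i" for i
    have t0: "norm (t i) \<le> (1 + norm z) * M" if "i < degree g" for i
    proof -
      have "norm (t i) \<le> norm (s (Suc i)) + norm z * norm (s i)"
        unfolding t_def by (metis norm_triangle_ineq4 norm_mult)
      also have "\<dots> \<le> M + norm z * M"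
        using s(1) that dh by (intro add_mono mult_left_mono) auto
      finally show ?thesis by (simp add: algebra_simps)
    qed
    have ch0: "coeff h 0 = - z * coeff g 0"
      and chS: "\<And>i. coeff h (Suc i) = coeff g i - z * coeff g (Suc i)"
      unfolding g by auto
    have "(\<Sum>i\<le>degree g. coeff g i * t (k + i)) = (\<Sum>i\<le>degree h. coeff h i * s (k + i))" for k
    proof -
      have "(\<Sum>i\<le>degree h. coeff h i * s (k + i)) =
          coeff h 0 * s k + (\<Sum>i\<le>degree g. coeff h (Suc i) * s (k + Suc i))"
        unfolding dh by (subst sum.atMost_Suc_shift) simp
      also have "\<dots> = (\<Sum>i\<le>degree g. coeff g i * s (k + Suc i)) -
          z * (coeff g 0 * s k + (\<Sum>i\<le>degree g. coeff g (Suc i) * s (k + Suc i)))"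
        unfolding ch0 chS
        by (simp add: algebra_simps sum_subtractf sum_distrib_left)
      also have "coeff g 0 * s k + (\<Sum>i\<le>degree g. coeff g (Suc i) * s (k + Suc i)) =
          (\<Sum>i\<le>Suc (degree g). coeff g i * s (k + i))"
        by (subst sum.atMost_Suc_shift) simp
      also have "\<dots> = (\<Sum>i\<le>degree g. coeff g i * s (k + i))"
        by (simp add: coeff_eq_0)
      finally show ?thesis
        unfolding t_def by (simp add: algebra_simps sum_subtractf sum_distrib_left)
    qed
    then have tC: "norm (t k) \<le> C" for k
      using C[of t] t0 s(2) by auto
    show ?thesis
    proof (induction k)
      case 0
      then show ?case using s(1) dh by (simp add: le_max_iff_disj)
    next
      case (Suc k)
      have "C = (C / (1 - norm z)) * (1 - norm z)"
        using z1 by simp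
      also have "\<dots> \<le> ?D * (1 - norm z)"
        using z1 by (intro mult_right_mono) auto
      finally have CD: "C \<le> ?D * (1 - norm z)" .
      have "norm (s (Suc k)) = norm (t k + z * s k)"
        unfolding t_def by simp
      also have "\<dots> \<le> ?D * (1 - norm z) + norm z * ?D"
        using tC[of k] CD Suc by (intro order_trans[OF norm_triangle_ineq] add_mono)
          (auto simp: norm_mult intro: mult_left_mono)
      finally show ?case by (simp add: algebra_simps)
    qed
  qed
  then show ?case by blast
qed

lemma of_rat_poly_monic_int:
  "map_poly of_rat (monom 1 d - (\<Sum>i<d. monom (of_int (a i)) i)) =
     (monom 1 d - (\<Sum>i<d. monom (of_int (a i)) i) :: 'a::field_char_0 poly)"
  by (intro poly_eqI) (auto simp: coeff_map_poly coeff_sum of_rat_diff of_rat_sum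
       intro!: sum.cong)

lemma eventually_periodic_if_finite:
  fixes f :: "'a \<Rightarrow> 'a"
  assumes "finite A" "\<And>k. k \<ge> k0 \<Longrightarrow> (f ^^ k) x \<in> A"
  obtains k N where "k \<ge> k0" "N \<ge> 1" "(f ^^ N) ((f ^^ k) x) = (f ^^ k) x"
proof -
  have "(\<lambda>k. (f ^^ k) x) ` {k0..} \<subseteq> A"
    using assms(2) by auto
  then have "finite ((\<lambda>k. (f ^^ k) x) ` {k0..})"
    using assms(1) finite_subset by blast
  then have "\<not> inj_on (\<lambda>k. (f ^^ k) x) {k0..}"
    using finite_imageD infinite_Ici by blast
  then obtain i j where "i \<ge> k0" "j \<ge> k0" "i \<noteq> j" "(f ^^ i) x = (f ^^ j) x"
    by (auto simp: inj_on_def)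
  then obtain i j where ij: "i \<ge> k0" "i < j" "(f ^^ j) x = (f ^^ i) x"
    by (metis linorder_neqE_nat)
  have "(f ^^ (j - i)) ((f ^^ i) x) = (f ^^ i) x"
    using ij by (metis funpow_add comp_apply le_add_diff_inverse2 less_imp_le)
  then show ?thesis
    using that[of i "j - i"] ij by simp
qed

section \<open>The powers of \<open>\<beta>\<close> and the coefficients \<open>r j\<close>\<close>

locale pisot_shift_radix =
  fixes \<beta> :: real and d :: nat and a :: "nat \<Rightarrow> int"
  assumes pisot: "pisot \<beta>"
    and d2: "d \<ge> 2"
    and minpoly: "is_minimal_polynomial \<beta> (monom 1 d - (\<Sum>i<d. monom (of_int (a i)) i))"
begin

abbreviation \<tau> :: "(nat \<Rightarrow> int) \<Rightarrow> nat \<Rightarrow> int" where "\<tau> \<equiv> tau \<beta> d a"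
abbreviation \<tau>s :: "(nat \<Rightarrow> int) \<Rightarrow> nat \<Rightarrow> int" where "\<tau>s \<equiv> tau_star \<beta> d a"
abbreviation lm :: "(nat \<Rightarrow> int) \<Rightarrow> real" where "lm \<equiv> lam \<beta> d a"
abbreviation r :: "nat \<Rightarrow> real" where "r \<equiv> r_coeff \<beta> a"
abbreviation lI :: "nat \<Rightarrow> int" where "lI \<equiv> l_I d"
abbreviation Q :: "(nat \<Rightarrow> int) set" where "Q \<equiv> Q_set \<beta> d a"
abbreviation P :: "(nat \<Rightarrow> int) set" where "P \<equiv> P_set \<beta> d a"
abbreviation V :: "(nat \<Rightarrow> int) set" where "V \<equiv> V_set \<beta> d a"
abbreviation F :: "(nat \<Rightarrow> int) set" where "F \<equiv> F_set \<beta> d a"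

lemma beta_gt_1: "\<beta> > 1"
  using pisot by (simp add: pisot_def)

lemma no_small_annihilator:
  fixes q :: "rat poly"
  assumes "poly (map_poly of_rat q) \<beta> = 0" "degree q < d"
  shows "q = 0"
proof (rule ccontr)
  assume "q \<noteq> 0"
  moreover have "degree (monom (1::rat) d - (\<Sum>i<d. monom (of_int (a i)) i)) \<ge> d"
    by (intro le_degree) (simp add: coeff_sum)
  ultimately show False
    using minpoly assms by (fastforce simp: is_minimal_polynomial_def)
qed

lemma no_small_relation:
  fixes c :: "nat \<Rightarrow> int"
  assumes "(\<Sum>i<d. of_int (c i) * \<beta> ^ i) = 0" "i < d"
  shows "c i = 0"
proof -
  define q where "q = (\<Sum>i<d. monom (of_int (c i) :: rat) i)"
  have cq: "coeff q k = (if k < d then of_int (c k) else 0)" for k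
    unfolding q_def by (auto simp: coeff_sum)
  have "map_poly of_rat q = (\<Sum>i<d. monom (of_int (c i) :: real) i)"
    by (intro poly_eqI) (auto simp: coeff_map_poly coeff_sum cq)
  then have "poly (map_poly of_rat q) \<beta> = 0"
    using assms(1) by (simp add: poly_sum poly_monom)
  moreover have "degree q < d"
    using d2 by (intro degree_lessI) (auto simp: cq)
  ultimately show ?thesis
    using no_small_annihilator[of q] cq[of i] assms(2) by simp
qed

lemma beta_power_d: "\<beta> ^ d = (\<Sum>i<d. of_int (a i) * \<beta> ^ i)"
  using minpoly by (simp add: is_minimal_polynomial_def of_rat_poly_monic_int poly_sum poly_monom)

text \<open>Otherwise dividing the minimal equation by \<open>\<beta>\<close> would give a monic
  relation of degree \<open>d - 1\<close>.\<close>

lemma a0_nonzero: "a 0 \<noteq> 0"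
proof
  assume a0: "a 0 = 0"
  define c where "c i = (if i = d - 1 then 1 else - a (Suc i))" for i
  obtain e where e: "d = Suc e" using d2 by (cases d) auto
  have "\<beta> * \<beta> ^ e = \<beta> * (\<Sum>i<e. of_int (a (Suc i)) * \<beta> ^ i)"
    using beta_power_d a0 unfolding e
    by (subst (asm) sum.lessThan_Suc_shift) (simp add: sum_distrib_left algebra_simps)
  then have "\<beta> ^ e = (\<Sum>i<e. of_int (a (Suc i)) * \<beta> ^ i)"
    using beta_gt_1 by simp
  then have "(\<Sum>i<d. of_int (c i) * \<beta> ^ i) = 0"
    unfolding e c_def by (simp add: sum_negf)
  from no_small_relation[OF this, of "d - 1"] show False
    using d2 by (simp add: c_def)
qed

lemma r_0 [simp]: "r 0 = 0"
  by (simp add: r_coeff_def)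

text \<open>This is the recursion of synthetic division by X - \<open>\<beta>\<close>. It yields
  both the factorization of the minimal polynomial and the conjugacy of \<open>\<tau>\<close> with
  the beta-transformation.\<close>

lemma beta_r_Suc: "\<beta> * r (Suc j) = of_int (a j) + r j"
proof -
  have "r (Suc j) = of_int (a j) / \<beta> + (\<Sum>i=1..j. of_int (a (j - i)) / \<beta> ^ Suc i)"
    unfolding r_coeff_def
    by (subst sum.atLeast_Suc_atMost, simp, subst sum.shift_bounds_cl_Suc_ivl) simp
  moreover have "\<beta> * (\<Sum>i=1..j. of_int (a (j - i)) / \<beta> ^ Suc i) = r j"
    using beta_gt_1 unfolding r_coeff_def by (simp add: sum_distrib_left)
  ultimately show ?thesis
    using beta_gt_1 by (simp add: algebra_simps)
qed

lemma r_power: "\<beta> ^ j * r j = (\<Sum>i<j. of_int (a i) * \<beta> ^ i)"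
proof (induction j)
  case (Suc j)
  have "\<beta> ^ Suc j * r (Suc j) = \<beta> ^ j * (of_int (a j) + r j)"
    by (metis beta_r_Suc mult.assoc power_Suc2)
  then show ?case using Suc by (simp add: algebra_simps)
qed simp

lemma r_d: "r d = 1"
proof -
  have "\<beta> ^ d * r d = \<beta> ^ d * 1"
    using r_power[of d] beta_power_d by simp
  moreover have "\<beta> ^ d \<noteq> 0"
    using beta_gt_1 by simp
  ultimately show ?thesis
    using mult_left_cancel by blast
qed

lemma r_pred: "r (d - 1) = \<beta> - of_int (a (d - 1))"
  using beta_r_Suc[of "d - 1"] r_d d2 by simp

section \<open>The cofactor of X - \<open>\<beta>\<close> in the minimal polynomial\<close>

text \<open>Quotient of the minimal polynomial by X - \<open>\<beta>\<close>. The leading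
  coefficient is \<open>r d = 1\<close>, and the lower ones are the weights of \<open>lm\<close>, so
  the recurrence of this polynomial describes \<open>\<tau>\<close> up to rounding.\<close>

definition cofactor :: "complex poly" where
  "cofactor = monom 1 (d - 1) + (\<Sum>j<d - 1. monom (complex_of_real (r (Suc j))) j)"

lemma coeff_cofactor:
  "coeff cofactor k = (if k < d then complex_of_real (r (Suc k)) else 0)"
  using d2 r_d by (auto simp: cofactor_def coeff_sum)

lemma degree_cofactor: "degree cofactor = d - 1"
  using d2 r_d by (intro antisym degree_le le_degree) (auto simp: coeff_cofactor)

lemma minpoly_factorization:
  "(monom 1 d - (\<Sum>i<d. monom (of_int (a i)) i) :: complex poly) =
     [:- complex_of_real \<beta>, 1:] * cofactor"
proof (rule poly_eqI)
  fix k
  have *: "complex_of_real \<beta> * complex_of_real (r (Suc j)) =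
      of_int (a j) + complex_of_real (r j)" for j
    by (metis beta_r_Suc of_real_add of_real_mult of_real_of_int_eq)
  show "coeff (monom 1 d - (\<Sum>i<d. monom (of_int (a i)) i) :: complex poly) k =
      coeff ([:- complex_of_real \<beta>, 1:] * cofactor) k"
  proof (cases k)
    case 0
    then show ?thesis
      using d2 *[of 0] by (simp add: coeff_sum coeff_cofactor)
  next
    case (Suc k')
    show ?thesis
    proof (cases "k = d")
      case True
      then have "k' < d" "\<not> Suc k' < d" "r (Suc k') = 1"
        using Suc r_d by auto
      then have "coeff ([:- complex_of_real \<beta>, 1:] * cofactor) k = 1"
        unfolding Suc by (simp add: coeff_cofactor)
      moreover have "coeff (monom 1 d - (\<Sum>i<d. monom (of_int (a i)) i) :: complex poly) k = 1"
        unfolding True by (simp add: coeff_sum)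
      ultimately show ?thesis by simp
    next
      case False
      then show ?thesis
        using Suc *[of k] by (simp add: coeff_sum coeff_cofactor)
    qed
  qed
qed

text \<open>A root \<open>\<beta>\<close> of the cofactor would be a double root of the minimal polynomial and hence a root
  of its derivative, which has smaller degree.\<close>

lemma cofactor_root_norm:
  assumes "poly cofactor z = 0"
  shows "norm z < 1"
proof -
  have z: "poly (monom 1 d - (\<Sum>i<d. monom (of_int (a i)) i)) z = 0"
    unfolding minpoly_factorization using assms by simp
  then have "z \<in> conjugates \<beta>"
    unfolding conjugates_def using minpoly by (auto simp: of_rat_poly_monic_int)
  moreover have "z \<noteq> complex_of_real \<beta>"
  proof
    assume zb: "z = complex_of_real \<beta>"
    define c where "c i = (if i = d - 1 then int d else - int (Suc i) * a (Suc i))" for i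
    let ?p = "monom 1 d - (\<Sum>i<d. monom (of_int (a i)) i) :: complex poly"
    have "poly (pderiv ?p) z = 0"
      unfolding minpoly_factorization pderiv_mult using assms zb by (simp add: pderiv_pCons)
    moreover have "pderiv ?p = (\<Sum>i<d. monom (of_int (c i)) i)"
      using d2 by (intro poly_eqI) (auto simp: coeff_pderiv coeff_sum c_def algebra_simps)
    ultimately have "complex_of_real (\<Sum>i<d. of_int (c i) * \<beta> ^ i) = 0"
      by (simp add: zb poly_sum poly_monom)
    then have "(\<Sum>i<d. of_int (c i) * \<beta> ^ i) = 0"
      using of_real_eq_0_iff by blast
    from no_small_relation[OF this, of "d - 1"] show False
      using d2 by (simp add: c_def)
  qed
  ultimately show ?thesis
    using pisot by (auto simp: pisot_def)
qed

section \<open>The maps \<open>\<tau>\<close> and \<open>\<tau>s\<close>, and integrality of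
  \<open>lm\<close>\<close>

lemma lam_add: "lm (u + v) = lm u + lm v"
  by (simp add: lam_def algebra_simps sum.distrib)

lemma lam_minus: "lm (- v) = - lm v"
  by (simp add: lam_def sum_negf)

lemma lam_zero [simp]: "lm 0 = 0"
  by (simp add: lam_def)

lemma tau_zero [simp]: "\<tau> 0 = 0"
  by (auto simp: tau_def fun_eq_iff)

lemma tau_funpow_zero [simp]: "(\<tau> ^^ k) 0 = 0"
  by (induction k) (simp_all only: funpow.simps id_apply comp_apply tau_zero)

lemma tau_in_int_vecs: "\<tau> l \<in> int_vecs d"
  using d2 by (auto simp: tau_def int_vecs_def)

lemma uminus_int_vecs: "l \<in> int_vecs d \<Longrightarrow> - l \<in> int_vecs d"
  by (auto simp: int_vecs_def)

lemma tau_star_in_int_vecs: "\<tau>s l \<in> int_vecs d"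
  by (simp add: tau_star_def uminus_int_vecs tau_in_int_vecs)

lemma l_I_in_int_vecs: "lI \<in> int_vecs d"
  using d2 by (auto simp: l_I_def int_vecs_def)

lemma tau_star_uminus: "\<tau>s (- l) = - \<tau> l" "\<tau> (- l) = - \<tau>s l"
  by (simp_all add: tau_star_def)

lemma tau_star_explicit:
  "\<tau>s l = (\<lambda>j. if 1 \<le> j \<and> j < d - 1 then l (j + 1)
          else if j = d - 1 then - \<lceil>lm l\<rceil> else 0)"
  by (auto simp: fun_eq_iff tau_star_def tau_def lam_minus ceiling_def)

lemma tau_star_eq: "\<tau>s l = \<tau> l - (if lm l \<in> \<int> then 0 else lI)"
  unfolding tau_star_explicit
  by (auto simp: fun_eq_iff tau_def l_I_def ceiling_altdef Ints_def elim!: Ints_cases)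

text \<open>The floor of a sum exceeds the sum of the floors by 0 or 1; in the latter case
  \<open>lm v\<close> is not an integer, so its ceiling accounts for the extra 1. The rounding is
  charged to \<open>v\<close> alone, which leaves the orbit of \<open>u\<close> intact.\<close>

lemma tau_add: "\<tau> (u + v) = \<tau> u + \<tau> v \<or> \<tau> (u + v) = \<tau> u + \<tau>s v"
proof -
  consider "\<lfloor>lm u + lm v\<rfloor> = \<lfloor>lm u\<rfloor> + \<lfloor>lm v\<rfloor>" | "\<lfloor>lm u + lm v\<rfloor> = \<lfloor>lm u\<rfloor> + \<lceil>lm v\<rceil>"
    by linarith
  then show ?thesis
    unfolding tau_star_explicit by cases (auto simp: fun_eq_iff tau_def lam_add)
qed

text \<open>Multiplying \<open>lm l = k\<close> by \<open>\<beta> ^ (d - 1)\<close> gives an integer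
  relation between powers below \<open>d\<close>, so all its coefficients \<open>g i\<close> vanish.
  For \<open>i < d - 1\<close>, \<open>g i\<close> is \<open>a 0 * l (d - 1 - i)\<close> plus terms
  in later entries of \<open>l\<close>: a triangular system with nonzero diagonal
  \<open>a 0\<close>, solved from the last entry down.\<close>

lemma lam_in_Ints_imp_zero:
  assumes "l \<in> int_vecs d" "lm l \<in> \<int>"
  shows "l = 0"
proof -
  obtain k where k: "lm l = of_int k"
    using assms(2) by (auto elim: Ints_cases)
  define g where "g i = (if i = d - 1 then - k else 0) +
      (\<Sum>j=1..d-1. if d - 1 - j \<le> i \<and> i < d - 1 then a (j + i - (d - 1)) * l j else 0)" for i
  have rp: "\<beta> ^ (d - 1) * r j = (\<Sum>i<d. if d - 1 - j \<le> i \<and> i < d - 1 then of_int (a (j + i - (d - 1))) * \<beta> ^ i else 0)"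
    if "j \<le> d - 1" for j
  proof -
    have "\<beta> ^ (d - 1) * r j = \<beta> ^ (d - 1 - j) * (\<beta> ^ j * r j)"
      using that by (metis mult.assoc power_add le_add_diff_inverse2)
    also have "\<dots> = (\<Sum>i<j. of_int (a i) * \<beta> ^ (d - 1 - j + i))"
      unfolding r_power by (simp add: sum_distrib_left power_add algebra_simps)
    also have "\<dots> = (\<Sum>i\<in>{d - 1 - j..<d - 1}. of_int (a (j + i - (d - 1))) * \<beta> ^ i)"
      using that by (intro sum.reindex_bij_witness[of _ "\<lambda>i. j + i - (d - 1)" "\<lambda>i. d - 1 - j + i"]) auto
    also have "\<dots> = (\<Sum>i<d. if d - 1 - j \<le> i \<and> i < d - 1 then of_int (a (j + i - (d - 1))) * \<beta> ^ i else 0)"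
      by (intro sum.mono_neutral_cong_left) auto
    finally show ?thesis .
  qed
  have term_g: "of_int (g i) * \<beta> ^ i = (if i = d - 1 then - of_int k * \<beta> ^ (d - 1) else 0) +
      (\<Sum>j=1..d-1. (if d - 1 - j \<le> i \<and> i < d - 1 then of_int (a (j + i - (d - 1))) * \<beta> ^ i else 0) * of_int (l j))" for i
    unfolding g_def of_int_add of_int_sum distrib_right sum_distrib_right
    by (intro arg_cong2[where f = "(+)"] sum.cong) auto
  have "(\<Sum>i<d. of_int (g i) * \<beta> ^ i) = - of_int k * \<beta> ^ (d - 1) +
      (\<Sum>i<d. \<Sum>j=1..d-1. (if d - 1 - j \<le> i \<and> i < d - 1 then of_int (a (j + i - (d - 1))) * \<beta> ^ i else 0) * of_int (l j))"
    unfolding term_g sum.distrib using d2 by simp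
  also have "(\<Sum>i<d. \<Sum>j=1..d-1. (if d - 1 - j \<le> i \<and> i < d - 1 then of_int (a (j + i - (d - 1))) * \<beta> ^ i else 0) * of_int (l j))
     = (\<Sum>j=1..d-1. \<beta> ^ (d - 1) * r j * of_int (l j))"
    by (subst sum.swap) (intro sum.cong refl, simp only: sum_distrib_right[symmetric] rp atLeastAtMost_iff)
  also have "\<dots> = \<beta> ^ (d - 1) * lm l"
    by (simp add: lam_def sum_distrib_left mult.assoc)
  finally have "(\<Sum>i<d. of_int (g i) * \<beta> ^ i) = 0"
    by (simp add: k)
  then have g0: "g i = 0" if "i < d" for i
    using no_small_relation that by blast
  have "l (d - 1 - i) = 0" for i
  proof (induction i rule: less_induct)
    case (less i)
    show ?case
    proof (cases "i < d - 1")
      case True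
      have "g i = (\<Sum>j=1..d-1. if j = d - 1 - i then a 0 * l j else 0)"
      proof -
        have "(if d - 1 - j \<le> i \<and> i < d - 1 then a (j + i - (d - 1)) * l j else 0) =
            (if j = d - 1 - i then a 0 * l j else 0)" if j: "j \<in> {1..d-1}" for j
        proof -
          consider "d - 1 - j < i" | "j = d - 1 - i" | "i < d - 1 - j"
            using j True by fastforce
          then show ?thesis
          proof cases
            case 1
            have "d - 1 - (d - 1 - j) = j"
              using j by auto
            then have "l j = 0"
              using less[OF 1] by metis
            moreover have "j \<noteq> d - 1 - i"
              using 1 True by auto
            ultimately show ?thesis by simp
          qed (use True in auto)
        qed
        moreover have "i \<noteq> d - 1"
          using True by simp
        ultimately show ?thesis
          unfolding g_def by (simp only: if_False add_0 cong: sum.cong)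
      qed
      also have "\<dots> = a 0 * l (d - 1 - i)"
      proof -
        have "d - 1 - i \<in> {1..d-1}"
          using True by auto
        then show ?thesis
          by (simp only: sum.delta finite_atLeastAtMost if_True)
      qed
      finally show ?thesis
        using g0[of i] True a0_nonzero by simp
    next
      \<comment> \<open>Here the truncated difference is 0, and entry 0 lies outside the index range
        of the encoding.\<close>
      case False
      then show ?thesis using assms(1) by (simp add: int_vecs_def)
    qed
  qed
  then have "l j = 0" if "j \<le> d - 1" for j
    using that by (metis diff_diff_cancel)
  then show ?thesis
    using assms(1) by (auto simp: int_vecs_def fun_eq_iff)
qed

section \<open>Finiteness of \<open>Q\<close> and \<open>P\<close>\<close>

lemma l_I_in_Q: "lI \<in> Q"
  unfolding Q_set_def using l_I_in_int_vecs by (auto intro!: exI[of _ "1::nat"])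

lemma Q_closed:
  assumes "l \<in> Q" "l' \<in> {\<tau> l, \<tau>s l}"
  shows "l' \<in> Q"
proof -
  obtain N :: nat and s where s: "N \<ge> 1" "s 1 = lI" "s N = l"
    "\<forall>n. 1 \<le> n \<and> n < N \<longrightarrow> s (n + 1) \<in> {\<tau> (s n), \<tau>s (s n)}"
    using assms(1) unfolding Q_set_def by blast
  let ?s = "s(Suc N := l')"
  have "?s (n + 1) \<in> {\<tau> (?s n), \<tau>s (?s n)}" if "1 \<le> n" "n < Suc N" for n
    using s assms(2) that by (cases "n = N") auto
  moreover have "?s 1 = lI" "?s (Suc N) = l'"
    using s by auto
  moreover have "l' \<in> int_vecs d"
    using assms(2) tau_in_int_vecs tau_star_in_int_vecs by auto
  ultimately show ?thesis
    unfolding Q_set_def by (intro CollectI conjI exI[of _ "Suc N"] exI[of _ ?s]) auto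
qed

lemma tau_in_Q: "l \<in> Q \<Longrightarrow> \<tau> l \<in> Q" and tau_star_in_Q: "l \<in> Q \<Longrightarrow> \<tau>s l \<in> Q"
  using Q_closed by auto

lemma Q_induct [consumes 1, case_names l_I step]:
  assumes "l \<in> Q" "R lI" "\<And>l l'. R l \<Longrightarrow> l' \<in> {\<tau> l, \<tau>s l} \<Longrightarrow> R l'"
  shows "R l"
proof -
  obtain N :: nat and s where s: "N \<ge> 1" "s 1 = lI" "s N = l"
    "\<forall>n. 1 \<le> n \<and> n < N \<longrightarrow> s (n + 1) \<in> {\<tau> (s n), \<tau>s (s n)}"
    using assms(1) unfolding Q_set_def by blast
  have "n \<le> N \<longrightarrow> R (s n)" if "n \<ge> 1" for n
    using that
  proof (induction n rule: nat_induct_at_least)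
    case base
    then show ?case using s(2) assms(2) by simp
  next
    case (Suc n)
    then show ?case using s(4) assms(3)[of "s n" "s (n + 1)"] by auto
  qed
  then show ?thesis using s by auto
qed

lemma Q_int_vecs: "l \<in> Q \<Longrightarrow> l \<in> int_vecs d"
  by (simp add: Q_set_def)

lemma tau_funpow_in_Q: "l \<in> Q \<Longrightarrow> (\<tau> ^^ k) l \<in> Q"
  by (induction k) (auto intro: tau_in_Q)

text \<open>The bound for recurrences concerns infinite sequences, so a finite path to
  \<open>l\<close> is prolonged by iterating \<open>\<tau>\<close>. Indices start at 0 here.\<close>

lemma Q_infinite_path:
  assumes "l \<in> Q"
  shows "\<exists>s n. s 0 = lI \<and> s n = l \<and> (\<forall>k. s (Suc k) \<in> {\<tau> (s k), \<tau>s (s k)})"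
  using assms
proof (induction rule: Q_induct)
  case l_I
  show ?case
    by (intro exI[of _ "\<lambda>k. (\<tau> ^^ k) lI"] exI[of _ 0]) simp
next
  case (step l l')
  then obtain s n where s: "s 0 = lI" "s n = l" "\<forall>k. s (Suc k) \<in> {\<tau> (s k), \<tau>s (s k)}"
    by blast
  let ?s = "\<lambda>k. if k \<le> n then s k else (\<tau> ^^ (k - Suc n)) l'"
  have steps: "?s (Suc k) \<in> {\<tau> (?s k), \<tau>s (?s k)}" for k
  proof -
    consider "k < n" | "k = n" | "k > n" by linarith
    then show ?thesis
    proof cases
      case 3
      then have "Suc k - Suc n = Suc (k - Suc n)" by simp
      with 3 show ?thesis by simp
    qed (use s step.hyps in auto)
  qed
  have "?s 0 = lI \<and> ?s (Suc n) = l' \<and> (\<forall>k. ?s (Suc k) \<in> {\<tau> (?s k), \<tau>s (?s k)})"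
    using s(1) steps by simp
  then show ?case by (intro exI[of _ ?s] exI[of _ "Suc n"])
qed

text \<open>Along a path in \<open>Q\<close> all vectors are windows of one scalar sequence, which satisfies the linear
  recurrence belonging to the cofactor of \<open>\<beta>\<close> up to an error of at most 1.\<close>

lemma finite_Q: "finite Q"
proof -
  have "cofactor \<noteq> 0"
    using coeff_cofactor[of "d - 1"] r_d d2 by auto
  \<comment> \<open>The first 1 bounds the entries of \<open>lI\<close>, the second the error made
    by taking a floor or a ceiling.\<close>
  from linear_recurrence_bounded[OF this cofactor_root_norm, of 1 1]
  obtain C where C: "\<And>\<sigma> k. (\<forall>i<d - 1. norm (\<sigma> i) \<le> 1) \<Longrightarrow>
      (\<forall>k. norm (\<Sum>i\<le>d - 1. coeff cofactor i * \<sigma> (k + i)) \<le> 1) \<Longrightarrow> norm (\<sigma> k) \<le> C"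
    unfolding degree_cofactor by blast
  have bound: "\<bar>l j\<bar> \<le> \<lceil>C\<rceil>" if lQ: "l \<in> Q" and j: "j \<in> {1..d - 1}" for l j
  proof -
    obtain s n where s: "s 0 = lI" "s n = l" and step: "\<And>k. s (Suc k) \<in> {\<tau> (s k), \<tau>s (s k)}"
      using Q_infinite_path[OF lQ] by blast
    \<comment> \<open>Both \<open>\<tau>\<close> and \<open>\<tau>s\<close> shift the entries to the
      left, so the first coordinates along the path determine all the others.\<close>
    define \<sigma> where "\<sigma> k = complex_of_int (s k 1)" for k
    have shift: "s (Suc k) j = s k (Suc j)" if "1 \<le> j" "j < d - 1" for k j
      using step[of k] that unfolding tau_star_explicit tau_def by auto
    have "j < d - 1 \<longrightarrow> (\<forall>k. s k (Suc j) = s (k + j) 1)" for j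
      by (induction j) (simp, metis Suc_eq_plus1_left Suc_lessD add_Suc_right add_Suc_shift le_add1 shift)
    then have window: "complex_of_int (s k (Suc j)) = \<sigma> (k + j)" if "j < d - 1" for k j
      using that unfolding \<sigma>_def by metis
    have "norm (\<sigma> i) \<le> 1" if "i < d - 1" for i
      using window[OF that, of 0] s(1) by (auto simp: l_I_def split: if_splits)
    moreover have "norm (\<Sum>i\<le>d - 1. coeff cofactor i * \<sigma> (k + i)) \<le> 1" for k
    proof -
      have d1: "Suc (d - 2) = d - 1" "d - 2 < d - 1"
        using d2 by auto
      \<comment> \<open>The top term of the recurrence is the newly appended entry, the negative of
        a rounded \<open>lm (s k)\<close>; the remaining terms add up to \<open>lm (s k)\<close>
        itself.\<close>
      have "\<sigma> (k + (d - 1)) = complex_of_int (s (Suc k) (d - 1))"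
        using window[OF d1(2), of "Suc k"] d1 by (metis add_Suc_right add_Suc)
      moreover have "(\<Sum>i<d - 1. coeff cofactor i * \<sigma> (k + i)) = complex_of_real (lm (s k))"
      proof -
        have "(\<Sum>i<d - 1. coeff cofactor i * \<sigma> (k + i)) =
            (\<Sum>i<d - 1. complex_of_real (r (Suc i) * of_int (s k (Suc i))))"
          by (intro sum.cong) (auto simp: coeff_cofactor simp flip: window)
        then show ?thesis
          by (simp add: lam_def sum.atLeast1_atMost_eq)
      qed
      moreover have "coeff cofactor (d - 1) = 1"
        using d2 r_d by (simp add: coeff_cofactor)
      ultimately have "(\<Sum>i\<le>d - 1. coeff cofactor i * \<sigma> (k + i)) =
          complex_of_real (lm (s k) + of_int (s (Suc k) (d - 1)))"
        by (simp flip: lessThan_Suc_atMost)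
      moreover have "\<bar>lm (s k) + of_int (s (Suc k) (d - 1))\<bar> \<le> 1"
        using step[of k] d2 unfolding tau_star_explicit tau_def by auto linarith+
      ultimately show ?thesis
        by (metis norm_of_real)
    qed
    ultimately have "norm (\<sigma> (n + (j - 1))) \<le> C"
      using C[of \<sigma>] by blast
    also have "\<sigma> (n + (j - 1)) = complex_of_int (l j)"
      using window[of "j - 1" n] j s(2) by auto
    finally show ?thesis by simp linarith
  qed
  have "Q \<subseteq> {l. \<forall>j. (j \<in> {1..d - 1} \<longrightarrow> l j \<in> {- \<lceil>C\<rceil>..\<lceil>C\<rceil>}) \<and> (j \<notin> {1..d - 1} \<longrightarrow> l j = 0)}"
    using bound Q_int_vecs by (fastforce simp: int_vecs_def abs_le_iff)
  then show ?thesis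
    by (rule finite_subset) (intro finite_set_of_finite_funs; simp)
qed

lemma finite_P: "finite P"
  using finite_Q by (rule finite_subset[rotated]) (auto simp: P_set_def)

lemma P_le_delta:
  assumes "l \<in> P" "j \<in> {1..d - 1}"
  shows "\<bar>l j\<bar> \<le> delta \<beta> d a"
proof -
  have "{\<bar>l j\<bar> | l j. l \<in> P \<and> j \<in> {1..d-1}} = (\<lambda>(l, j). \<bar>l j\<bar>) ` (P \<times> {1..d-1})"
    by (auto simp: image_iff) blast
  then have "finite {\<bar>l j\<bar> | l j. l \<in> P \<and> j \<in> {1..d-1}}"
    using finite_P by simp
  then show ?thesis
    unfolding delta_def using assms by (intro Max_ge) auto
qed

section \<open>Additive structure of \<open>V\<close>\<close>

lemma V_iff:
  "v \<in> V \<longleftrightarrow> (\<exists>m\<ge>1. \<exists>\<omega>. v = (\<lambda>j. - (\<Sum>n<m. int (\<omega> n) * (\<tau> ^^ n) lI j)))"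
proof -
  have sum_apply: "(\<Sum>n=1..m. (\<lambda>j. int (\<omega> n) * (\<tau> ^^ (n - 1)) lI j)) =
      (\<lambda>j. \<Sum>n<m. int (\<omega> (Suc n)) * (\<tau> ^^ n) lI j)" for m and \<omega> :: "nat \<Rightarrow> nat"
    by (induction m) (auto simp: fun_eq_iff)
  show ?thesis
  proof
    assume "v \<in> V"
    then obtain m \<omega> where "m \<ge> 1" "v = - (\<Sum>n=1..m. (\<lambda>j. int (\<omega> n) * (\<tau> ^^ (n - 1)) lI j))"
      unfolding V_set_def by blast
    then show "\<exists>m\<ge>1. \<exists>\<omega>. v = (\<lambda>j. - (\<Sum>n<m. int (\<omega> n) * (\<tau> ^^ n) lI j))"
      unfolding sum_apply
      by (intro exI[of _ m] conjI exI[of _ "\<lambda>n. \<omega> (Suc n)"]) (auto simp: fun_eq_iff)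
  next
    assume "\<exists>m\<ge>1. \<exists>\<omega>. v = (\<lambda>j. - (\<Sum>n<m. int (\<omega> n) * (\<tau> ^^ n) lI j))"
    then obtain m \<omega> where m: "m \<ge> 1" "v = (\<lambda>j. - (\<Sum>n<m. int (\<omega> n) * (\<tau> ^^ n) lI j))"
      by blast
    have "v = - (\<Sum>n=1..m. (\<lambda>j. int (\<omega> (n - 1)) * (\<tau> ^^ (n - 1)) lI j))"
      unfolding m(2) sum_apply[of "\<lambda>n. \<omega> (n - 1)"] by (auto simp: fun_eq_iff)
    then show "v \<in> V"
      unfolding V_set_def using m(1) by (intro CollectI exI[of _ m] exI[of _ "\<lambda>n. \<omega> (n - 1)"]) simp
  qed
qed

lemma V_zero: "0 \<in> V"
  unfolding V_iff by (intro exI[of _ 1] conjI exI[of _ "\<lambda>_. 0"]) (auto simp: fun_eq_iff)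

lemma V_minus:
  assumes "v \<in> V"
  shows "v - (\<tau> ^^ k) lI \<in> V"
proof -
  obtain m \<omega> where m: "m \<ge> 1" "v = (\<lambda>j. - (\<Sum>n<m. int (\<omega> n) * (\<tau> ^^ n) lI j))"
    using assms V_iff by blast
  let ?m = "max m (Suc k)"
  let ?\<omega> = "\<lambda>n. (if n < m then \<omega> n else 0) + (if n = k then 1 else 0)"
  have "(\<Sum>n<?m. int (?\<omega> n) * (\<tau> ^^ n) lI j) =
      (\<Sum>n<m. int (\<omega> n) * (\<tau> ^^ n) lI j) + (\<tau> ^^ k) lI j" for j
  proof -
    have "(\<Sum>n<?m. int (?\<omega> n) * (\<tau> ^^ n) lI j) =
        (\<Sum>n<?m. if n < m then int (\<omega> n) * (\<tau> ^^ n) lI j else 0) +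
        (\<Sum>n<?m. if n = k then (\<tau> ^^ n) lI j else 0)"
      by (subst sum.distrib[symmetric], intro sum.cong) (auto simp: algebra_simps)
    also have "(\<Sum>n<?m. if n < m then int (\<omega> n) * (\<tau> ^^ n) lI j else 0) =
        (\<Sum>n<m. int (\<omega> n) * (\<tau> ^^ n) lI j)"
      by (intro sum.mono_neutral_cong_right) auto
    finally show ?thesis by simp
  qed
  then have "v - (\<tau> ^^ k) lI = (\<lambda>j. - (\<Sum>n<?m. int (?\<omega> n) * (\<tau> ^^ n) lI j))"
    using m(2) by (auto simp: fun_eq_iff)
  then show ?thesis
    unfolding V_iff using m(1) by (intro exI[of _ ?m] conjI exI[of _ ?\<omega>]) linarith
qed

text \<open>Building up the weights by unit subtractions means that only one orbit vector of
  \<open>lI\<close>, an element of \<open>Q\<close>, has to be followed as a carry at a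
  time.\<close>

lemma V_induct [consumes 1, case_names zero minus]:
  assumes "v \<in> V" "R 0" "\<And>v k. v \<in> V \<Longrightarrow> R v \<Longrightarrow> R (v - (\<tau> ^^ k) lI)"
  shows "R v"
proof -
  obtain m \<omega> where v: "v = (\<lambda>j. - (\<Sum>n<m. int (\<omega> n) * (\<tau> ^^ n) lI j))"
    using assms(1) V_iff by blast
  let ?v = "\<lambda>m \<omega>. (\<lambda>j. - (\<Sum>n<m. int (\<omega> n) * (\<tau> ^^ n) lI j))"
  have "?v m \<omega> \<in> V \<and> R (?v m \<omega>)"
  proof (induction m)
    case 0
    have "?v 0 \<omega> = 0" by (auto simp: fun_eq_iff)
    then show ?case using V_zero assms(2) by metis
  next
    case (Suc m)
    \<comment> \<open>The inner induction raises the weight of the \<open>m\<close>-th orbit vector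
      one unit at a time.\<close>
    have *: "(\<lambda>j. ?v m \<omega> j - int c * (\<tau> ^^ m) lI j) \<in> V \<and>
        R (\<lambda>j. ?v m \<omega> j - int c * (\<tau> ^^ m) lI j)" for c
    proof (induction c)
      case 0
      then show ?case using Suc by simp
    next
      case (Suc c)
      have eq: "(\<lambda>j. ?v m \<omega> j - int (Suc c) * (\<tau> ^^ m) lI j) =
          (\<lambda>j. ?v m \<omega> j - int c * (\<tau> ^^ m) lI j) - (\<tau> ^^ m) lI"
        by (auto simp: fun_eq_iff algebra_simps)
      show ?case
        unfolding eq by (intro conjI V_minus assms(3) conjunct1[OF Suc] conjunct2[OF Suc])
    qed
    have eq: "?v (Suc m) \<omega> = (\<lambda>j. ?v m \<omega> j - int (\<omega> m) * (\<tau> ^^ m) lI j)"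
      by (auto simp: fun_eq_iff)
    show ?case
      unfolding eq by (rule *)
  qed
  then show ?thesis by (simp add: v)
qed

lemma V_add:
  assumes "u \<in> V" "v \<in> V"
  shows "u + v \<in> V"
  using assms(2)
proof (induction rule: V_induct)
  case zero
  then show ?case using assms(1) by simp
next
  case (minus v k)
  then show ?case
    unfolding add_diff_eq by (intro V_minus)
qed

lemma V_int_vecs: "v \<in> V \<Longrightarrow> v \<in> int_vecs d"
proof (induction rule: V_induct)
  case (minus v k)
  have "(\<tau> ^^ k) lI \<in> int_vecs d"
    using tau_funpow_in_Q l_I_in_Q Q_int_vecs by blast
  with minus show ?case by (simp add: int_vecs_def)
qed (simp add: int_vecs_def)

lemma neg_multiple_l_I_in_V: "(\<lambda>j. - int c * lI j) \<in> V"
  unfolding V_iff by (intro exI[of _ 1] conjI exI[of _ "\<lambda>_. c"]) auto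

section \<open>Carries, and the symmetry of \<open>Q\<close>\<close>

lemma F_if_funpow_in_F:
  assumes "(\<tau> ^^ k) l \<in> F" "l \<in> int_vecs d"
  shows "l \<in> F"
proof -
  obtain m where "(\<tau> ^^ (m + k)) l = 0"
    using assms(1) by (auto simp: F_set_def funpow_add)
  then show ?thesis
    using assms(2) unfolding F_set_def by blast
qed

lemma zero_in_F: "0 \<in> F"
  by (auto simp: F_set_def int_vecs_def)

text \<open>Adding \<open>q\<close> to a vector changes each step of its \<open>\<tau>\<close>-orbit by a step of \<open>\<tau>\<close> or
  \<open>\<tau>\<^sup>*\<close> applied to the carry. Since \<open>\<tau>\<^sup>*\<close> is \<open>\<tau>\<close> conjugated by negation, carries that start
  in \<open>- Q\<close> stay there.\<close>

lemma carry_in_neg_Q: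
  assumes "w \<in> Q"
  shows "\<exists>q\<in>Q. (\<tau> ^^ k) (v - w) = (\<tau> ^^ k) v - q"
proof (induction k)
  case 0
  then show ?case using assms by auto
next
  case (Suc k)
  then obtain q where q: "q \<in> Q" "(\<tau> ^^ k) (v - w) = (\<tau> ^^ k) v - q"
    by blast
  have "(\<tau> ^^ Suc k) (v - w) = \<tau> ((\<tau> ^^ k) v + - q)"
    unfolding funpow.simps comp_apply q(2) by (simp only: diff_conv_add_uminus)
  then have "(\<tau> ^^ Suc k) (v - w) = (\<tau> ^^ Suc k) v - \<tau>s q \<or>
      (\<tau> ^^ Suc k) (v - w) = (\<tau> ^^ Suc k) v - \<tau> q"
    using tau_add[of "(\<tau> ^^ k) v" "- q"]
    unfolding tau_star_uminus funpow.simps comp_apply add_uminus_conv_diff by metis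
  then show ?case
    using q(1) tau_in_Q tau_star_in_Q by blast
qed

text \<open>Negation exchanges \<open>\<tau>\<close> and \<open>\<tau>s\<close>, so the negative of
  a path from \<open>lI\<close> is a path from \<open>- lI\<close>, and \<open>Q\<close> is closed
  under both maps.\<close>

lemma neg_l_I_in_Q_imp_symmetric:
  assumes "- lI \<in> Q" "l \<in> Q"
  shows "- l \<in> Q"
  using assms(2)
proof (induction rule: Q_induct)
  case (step l l')
  then show ?case
    using tau_in_Q[of "- l"] tau_star_in_Q[of "- l"] unfolding tau_star_uminus by blast
qed (rule assms(1))

text \<open>As \<open>lm m\<close> is not an integer, its ceiling exceeds its floor by 1, so
  \<open>\<tau>s m\<close> is \<open>\<tau> m - lI\<close>.\<close>

lemma neg_l_I_in_Q:
  assumes "m \<in> Q" "m \<noteq> 0" "\<tau> m = 0"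
  shows "- lI \<in> Q"
proof -
  have "lm m \<notin> \<int>"
    using lam_in_Ints_imp_zero Q_int_vecs assms by blast
  then have "\<tau>s m = - lI"
    using assms(3) by (auto simp: tau_star_eq fun_eq_iff)
  then show ?thesis
    using tau_star_in_Q[OF assms(1)] by metis
qed

section \<open>Hypotheses (i) and (ii) force \<open>V\<close> into \<open>F\<close>\<close>

context
  assumes P_backward: "{l \<in> int_vecs d. \<tau> l \<in> P} \<subseteq> P"
    and box_V_subset_F:
      "{l \<in> int_vecs d. \<forall>j\<in>{1..d-1}. l j \<in> {- delta \<beta> d a..delta \<beta> d a}} \<inter> V \<subseteq> F"
begin

lemma P_backward_funpow:
  assumes "(\<tau> ^^ k) l \<in> P" "l \<in> int_vecs d"
  shows "l \<in> P"
  using assms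
proof (induction k)
  case (Suc k)
  have "(\<tau> ^^ k) l \<in> int_vecs d"
    using Suc.prems(2) by (cases k) (auto simp: tau_in_int_vecs)
  then have "(\<tau> ^^ k) l \<in> P"
    using Suc.prems P_backward by auto
  then show ?case using Suc by blast
qed simp

text \<open>Interface to hypothesis (ii), applied with \<open>l = v\<close> and with
  \<open>l = - v\<close>.\<close>

lemma small_V_in_F:
  assumes "v \<in> V" "l \<in> P" "\<And>j. j \<in> {1..d - 1} \<Longrightarrow> \<bar>v j\<bar> \<le> \<bar>l j\<bar>"
  shows "v \<in> F"
proof -
  have "v j \<in> {- delta \<beta> d a..delta \<beta> d a}" if "j \<in> {1..d - 1}" for j
    using assms(3)[OF that] P_le_delta[OF assms(2) that] by auto
  then show ?thesis
    using box_V_subset_F assms(1) V_int_vecs by blast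
qed

text \<open>If no nonzero element of \<open>Q\<close> is mapped to \<open>0\<close>, then \<open>P\<close> contains all of them, and as
  \<open>\<tau>\<close> and \<open>\<tau>\<^sup>*\<close> differ by \<open>l\<^sub>I\<close>, subtracting \<open>l\<^sub>I\<close> does not lead out of the finite set
  \<open>P \<union> {0}\<close> before \<open>0\<close> is reached.\<close>

lemma Q_in_multiples_of_l_I:
  assumes no_zero: "\<And>m. m \<in> Q \<Longrightarrow> m \<noteq> 0 \<Longrightarrow> \<tau> m \<noteq> 0"
    and q: "q \<in> Q" "q \<noteq> 0"
  shows "q \<in> P \<and> (\<exists>c. q = (\<lambda>j. int c * lI j))"
proof -
  have orbit: "(\<tau> ^^ k) l \<in> Q - {0}" if "l \<in> Q - {0}" for l k
    using that by (induction k) (auto intro: tau_in_Q dest: no_zero)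
  have QP: "l \<in> P" if l: "l \<in> Q - {0}" for l
  proof -
    \<comment> \<open>The orbit enters a cycle inside \<open>Q - {0}\<close>, hence inside
      \<open>P\<close>; hypothesis (i) then leads back along the orbit to \<open>l\<close>.\<close>
    obtain k N where kN: "N \<ge> 1" "(\<tau> ^^ N) ((\<tau> ^^ k) l) = (\<tau> ^^ k) l"
      using eventually_periodic_if_finite[of "Q - {0}" 0 \<tau> l] finite_Q orbit[OF l] by blast
    then have "(\<tau> ^^ k) l \<in> P"
      using orbit[OF l, of k] by (auto simp: P_set_def)
    then show ?thesis
      using P_backward_funpow Q_int_vecs l by blast
  qed
  have minus: "l - lI \<in> P \<union> {0}" if l: "l \<in> P" for l
  proof -
    obtain N where N: "N \<ge> 1" "(\<tau> ^^ N) l = l" and lQ: "l \<in> Q - {0}"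
      using l by (auto simp: P_set_def)
    \<comment> \<open>\<open>m\<close> is the predecessor of \<open>l\<close> on its cycle, so
      \<open>\<tau>s\<close> maps it to \<open>l - lI\<close>, which is therefore in
      \<open>Q\<close>.\<close>
    define m where "m = (\<tau> ^^ (N - 1)) l"
    have m: "m \<in> Q - {0}"
      unfolding m_def by (rule orbit[OF lQ])
    have "\<tau> m = (\<tau> ^^ Suc (N - 1)) l"
      by (simp add: m_def)
    then have "\<tau> m = l"
      using N by simp
    moreover have "lm m \<notin> \<int>"
      using lam_in_Ints_imp_zero Q_int_vecs m by blast
    ultimately have "\<tau>s m = l - lI"
      by (simp add: tau_star_eq)
    then show ?thesis
      using QP tau_star_in_Q[of m] m by auto
  qed
  define f where "f c = (\<lambda>j. q j - int c * lI j)" for c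
  have "\<exists>c. f c = 0"
  proof (rule ccontr)
    assume nz: "\<nexists>c. f c = 0"
    have "f c \<in> P" for c
    proof (induction c)
      case 0
      then show ?case using QP q by (simp add: f_def)
    next
      case (Suc c)
      have "f (Suc c) = f c - lI"
        by (auto simp: f_def fun_eq_iff algebra_simps)
      then show ?case
        using minus[OF Suc] nz by (metis UnE singletonD)
    qed
    then have "range f \<subseteq> P"
      by auto
    then have "finite (range f)"
      using finite_P finite_subset by blast
    moreover have "inj f"
    proof (rule injI)
      fix b c assume "f b = f c"
      then have "f b (d - 1) = f c (d - 1)"
        by simp
      then show "b = c"
        by (simp add: f_def l_I_def)
    qed
    ultimately show False
      using finite_imageD by fastforce
  qed
  then obtain c where "f c = 0" by blast
  then have "q = (\<lambda>j. int c * lI j)"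
    by (auto simp: f_def fun_eq_iff)
  then show ?thesis
    using QP q by blast
qed

lemma periodic_neg_Q_in_P_or_F:
  assumes "- u \<in> Q" "u \<noteq> 0" "(\<tau> ^^ N) u = u" "N \<ge> 1"
  shows "u \<in> P \<or> u \<in> F"
proof (cases "\<exists>m\<in>Q. m \<noteq> 0 \<and> \<tau> m = 0")
  case True
  then have "u \<in> Q"
    using neg_l_I_in_Q neg_l_I_in_Q_imp_symmetric[OF _ assms(1)] unfolding minus_minus by blast
  then show ?thesis
    using assms by (auto simp: P_set_def)
next
  case False
  have "- u \<noteq> 0"
    unfolding neg_equal_0_iff_equal by (rule assms(2))
  then obtain c where c: "- u \<in> P" "- u = (\<lambda>j. int c * lI j)"
    using Q_in_multiples_of_l_I[OF _ assms(1)] False by blast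
  then have "u = (\<lambda>j. - int c * lI j)"
    by (auto simp: fun_eq_iff) (metis minus_equation_iff)
  then have "u \<in> V"
    using neg_multiple_l_I_in_V by metis
  then have "u \<in> F"
    by (rule small_V_in_F[OF _ c(1)]) simp
  then show ?thesis ..
qed

lemma V_subset_F: "v \<in> V \<Longrightarrow> v \<in> F"
proof (induction rule: V_induct)
  case zero
  then show ?case by (rule zero_in_F)
next
  case (minus v n)
  define w where "w = (\<tau> ^^ n) lI"
  have wQ: "w \<in> Q"
    unfolding w_def by (intro tau_funpow_in_Q l_I_in_Q)
  have vw: "v - w \<in> V" "v - w \<in> int_vecs d"
    unfolding w_def using V_minus[OF minus.hyps] V_int_vecs by blast+
  obtain k0 where k0: "(\<tau> ^^ k0) v = 0"
    using minus.IH by (auto simp: F_set_def)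
  \<comment> \<open>Once the orbit of \<open>v\<close> has reached 0, only the negated carry is
    left.\<close>
  have neg_Q: "(\<tau> ^^ k) (v - w) \<in> uminus ` Q" if "k \<ge> k0" for k
  proof -
    have "(\<tau> ^^ k) v = (\<tau> ^^ (k - k0)) ((\<tau> ^^ k0) v)"
      using that by (metis funpow_add comp_apply le_add_diff_inverse2)
    then have "(\<tau> ^^ k) v = 0"
      unfolding k0 tau_funpow_zero .
    then show ?thesis
      using carry_in_neg_Q[OF wQ, of k v] by (metis diff_0 imageI)
  qed
  obtain k N where kN: "k \<ge> k0" "N \<ge> 1" "(\<tau> ^^ N) ((\<tau> ^^ k) (v - w)) = (\<tau> ^^ k) (v - w)"
    using eventually_periodic_if_finite[of "uminus ` Q" k0 \<tau> "v - w"] finite_Q neg_Q by blast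
  define u where "u = (\<tau> ^^ k) (v - w)"
  have "u \<in> P \<or> u \<in> F"
  proof (cases "u = 0")
    case True
    then show ?thesis using zero_in_F by simp
  next
    case False
    have "- u \<in> Q"
      using neg_Q[OF kN(1)] unfolding u_def by (elim imageE) (simp only: minus_minus)
    then show ?thesis
      using periodic_neg_Q_in_P_or_F False kN(2,3) unfolding u_def by blast
  qed
  then have "v - w \<in> F"
  proof
    assume "u \<in> P"
    then have "v - w \<in> P"
      unfolding u_def using P_backward_funpow vw by blast
    then show ?thesis
      using small_V_in_F vw by blast
  next
    assume "u \<in> F"
    then show ?thesis
      unfolding u_def using F_if_funpow_in_F vw by blast
  qed
  then show ?case
    unfolding w_def .
qed

end

section \<open>Conjugacy with the beta-transformation and expansions of natural numbers\<close>

lemma beta_T_frac: "beta_T \<beta> x = frac (\<beta> * x)"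
  by (simp add: beta_T_def frac_def)

text \<open>By \<open>beta_r_Suc\<close>, multiplication by \<open>\<beta>\<close> lowers the index
  of each \<open>r j\<close> modulo integers, which is the shift in \<open>\<tau>\<close>. The
  subtracted floor becomes the new last entry, because \<open>\<beta>\<close> and
  \<open>r (d - 1)\<close> differ by an integer.\<close>

lemma beta_T_frac_lam: "beta_T \<beta> (frac (lm l)) = frac (lm (\<tau> l))"
proof -
  obtain e where e: "d = Suc (Suc e)"
    using d2 by (metis add_2_eq_Suc le_Suc_ex)
  have rp: "of_int (a (Suc e)) + r (Suc e) = \<beta>"
    using r_pred by (simp add: e)
  let ?t = "- \<lfloor>lm l\<rfloor>"
  have tau_Suc: "\<tau> l (Suc j) = (if j < e then l (Suc (Suc j)) else if j = e then ?t else 0)" for j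
    by (simp add: tau_def e)
  have "lm (\<tau> l) = (\<Sum>j<Suc e. r (Suc j) * of_int (\<tau> l (Suc j)))"
    by (simp add: lam_def e sum.atLeast1_atMost_eq)
  then have lam_tau: "lm (\<tau> l) =
      (\<Sum>j<e. r (Suc j) * of_int (l (Suc (Suc j)))) + r (Suc e) * of_int ?t"
    by (simp add: tau_Suc)
  have "\<beta> * frac (lm l) = (\<Sum>j<Suc e. \<beta> * r (Suc j) * of_int (l (Suc j))) + \<beta> * of_int ?t"
    unfolding frac_def lam_def e
    by (simp add: sum.atLeast1_atMost_eq sum_distrib_left algebra_simps)
  also have "(\<Sum>j<Suc e. \<beta> * r (Suc j) * of_int (l (Suc j))) =
      of_int (\<Sum>j<Suc e. a j * l (Suc j)) + (\<Sum>j<Suc e. r j * of_int (l (Suc j)))"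
    unfolding beta_r_Suc by (simp add: algebra_simps sum.distrib)
  also have "(\<Sum>j<Suc e. r j * of_int (l (Suc j))) = (\<Sum>j<e. r (Suc j) * of_int (l (Suc (Suc j))))"
    by (subst sum.lessThan_Suc_shift) simp
  also have "\<beta> * of_int ?t = of_int (a (Suc e) * ?t) + r (Suc e) * of_int ?t"
    unfolding of_int_mult distrib_right[symmetric] rp ..
  also have "of_int (\<Sum>j<Suc e. a j * l (Suc j)) + (\<Sum>j<e. r (Suc j) * of_int (l (Suc (Suc j)))) +
      (of_int (a (Suc e) * ?t) + r (Suc e) * of_int ?t) =
      of_int ((\<Sum>j<Suc e. a j * l (Suc j)) + a (Suc e) * ?t) + lm (\<tau> l)"
    unfolding lam_tau by simp
  finally show ?thesis
    unfolding beta_T_frac by (simp only: frac_add_of_int_left)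
qed

lemma beta_T_funpow_frac_lam: "(beta_T \<beta> ^^ k) (frac (lm l)) = frac (lm ((\<tau> ^^ k) l))"
  by (induction k) (simp_all add: beta_T_frac_lam)

lemma lam_l_I: "lm lI = r (d - 1)"
  using d2 by (simp add: lam_def l_I_def if_distrib cong: if_cong)

text \<open>\<open>lm lI = r (d - 1)\<close> is congruent to \<open>\<beta>\<close> modulo 1, so the
  orbit of \<open>lI\<close> encodes that of 1 from the first iterate on.\<close>

lemma beta_T_funpow_1: "(beta_T \<beta> ^^ Suc n) 1 = frac (lm ((\<tau> ^^ n) lI))"
proof -
  have "beta_T \<beta> 1 = frac (lm lI)"
    unfolding lam_l_I r_pred by (simp add: beta_T_def frac_def)
  then show ?thesis
    using beta_T_funpow_frac_lam[of n lI] by (simp add: funpow_swap1)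
qed

text \<open>Modulo integers these are the nonnegative integer combinations of the iterates of 1
  under \<open>beta_T \<beta>\<close>; the plus sign matches the minus sign in
  \<open>V\<close>.\<close>

definition V_residue :: "real \<Rightarrow> bool" where
  "V_residue x \<longleftrightarrow> (\<exists>v\<in>V. x + lm v \<in> \<int>)"

lemma V_residue_add:
  assumes "V_residue x" "V_residue y"
  shows "V_residue (x + y)"
proof -
  obtain u v where uv: "u \<in> V" "x + lm u \<in> \<int>" "v \<in> V" "y + lm v \<in> \<int>"
    using assms unfolding V_residue_def by blast
  have "x + y + lm (u + v) = (x + lm u) + (y + lm v)"
    unfolding lam_add by simp
  then show ?thesis
    unfolding V_residue_def using V_add[OF uv(1,3)] Ints_add[OF uv(2,4)] by metis
qed

lemma V_residue_Ints: "x \<in> \<int> \<Longrightarrow> V_residue x"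
  unfolding V_residue_def using V_zero by (intro bexI[of _ 0]) auto

lemma V_residue_nat_mult: "V_residue x \<Longrightarrow> V_residue (of_nat n * x)"
  by (induction n) (auto simp: distrib_right V_residue_Ints V_residue_add)

lemma V_residue_beta_T_1: "V_residue ((beta_T \<beta> ^^ n) 1)"
proof (cases n)
  case (Suc m)
  have "- (\<tau> ^^ m) lI \<in> V"
    using V_minus[OF V_zero, of m] unfolding diff_0 .
  moreover have "(beta_T \<beta> ^^ n) 1 + lm (- (\<tau> ^^ m) lI) \<in> \<int>"
    unfolding Suc beta_T_funpow_1 by (simp add: lam_minus frac_def)
  ultimately show ?thesis
    unfolding V_residue_def by blast
qed (simp add: V_residue_Ints)

lemma beta_T_funpow_nonneg: "x \<ge> 0 \<Longrightarrow> (beta_T \<beta> ^^ n) x \<ge> 0"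
  by (cases n) (simp_all add: beta_T_frac)

lemma floor_beta_T_nonneg: "x \<ge> 0 \<Longrightarrow> \<lfloor>\<beta> * (beta_T \<beta> ^^ n) x\<rfloor> \<ge> 0"
  using beta_T_funpow_nonneg[of x n] beta_gt_1 by simp

text \<open>One factor \<open>\<beta>\<close> is traded for a digit: \<open>\<beta>\<close> times an
  iterate of 1 is a nonnegative integer plus the next iterate. The digit contributes a multiple of
  \<open>\<beta> ^ i\<close>, covered by the induction hypothesis at the iterate 0.\<close>

lemma V_residue_power_beta_T_1: "V_residue (\<beta> ^ i * (beta_T \<beta> ^^ n) 1)"
proof (induction i arbitrary: n)
  case 0
  then show ?case by (simp add: V_residue_beta_T_1)
next
  case (Suc i)
  let ?c = "\<lfloor>\<beta> * (beta_T \<beta> ^^ n) 1\<rfloor>"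
  have "\<beta> ^ Suc i * (beta_T \<beta> ^^ n) 1 = of_nat (nat ?c) * (\<beta> ^ i * (beta_T \<beta> ^^ 0) 1) +
      \<beta> ^ i * (beta_T \<beta> ^^ Suc n) 1"
    using floor_beta_T_nonneg[of 1 n] by (simp add: beta_T_def algebra_simps)
  then show ?case
    using Suc V_residue_add V_residue_nat_mult by metis
qed

text \<open>The inner difference is the integer part of the expansion of
  \<open>\<beta> ^ n * y\<close>, a combination of powers of \<open>\<beta>\<close> with the first
  \<open>n\<close> digits as weights. The factor \<open>\<beta> ^ i\<close> is there for the
  induction, which trades \<open>n\<close> for \<open>i\<close>.\<close>

lemma V_residue_integer_part:
  assumes "y \<ge> 0"
  shows "V_residue (\<beta> ^ i * (\<beta> ^ n * y - (beta_T \<beta> ^^ n) y))"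
proof (induction n arbitrary: i)
  case 0
  then show ?case by (simp add: V_residue_Ints)
next
  case (Suc n)
  let ?c = "\<lfloor>\<beta> * (beta_T \<beta> ^^ n) y\<rfloor>"
  have "\<beta> ^ i * (\<beta> ^ Suc n * y - (beta_T \<beta> ^^ Suc n) y) =
      \<beta> ^ Suc i * (\<beta> ^ n * y - (beta_T \<beta> ^^ n) y) + of_nat (nat ?c) * (\<beta> ^ i * (beta_T \<beta> ^^ 0) 1)"
    using floor_beta_T_nonneg[of y n] assms by (simp add: beta_T_def algebra_simps)
  then show ?case
    using Suc V_residue_add V_residue_nat_mult V_residue_power_beta_T_1 by metis
qed

lemma property_F1_if_V_subset_F:
  assumes "V \<subseteq> F"
  shows "property_F1 \<beta>"
  unfolding property_F1_def finite_beta_expansion_def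
proof
  fix N :: nat
  define L where "L = beta_L \<beta> (real N)"
  define y where "y = real N / \<beta> ^ L"
  obtain n where "real N < \<beta> ^ n"
    using real_arch_pow[OF beta_gt_1] by blast
  then have "\<exists>n. real N / \<beta> ^ n < 1"
    using beta_gt_1 by (intro exI[of _ n]) simp
  then have y: "0 \<le> y" "y < 1"
    unfolding y_def L_def beta_L_def using beta_gt_1 by (auto intro: LeastI_ex)
  have "V_residue (\<beta> ^ 0 * (\<beta> ^ L * y - (beta_T \<beta> ^^ L) y))"
    using V_residue_integer_part y by blast
  then obtain v where v: "v \<in> V" "real N - (beta_T \<beta> ^^ L) y + lm v \<in> \<int>"
    unfolding V_residue_def y_def using beta_gt_1 by auto
  \<comment> \<open>The integer \<open>N\<close> drops out modulo 1, so the fractional part of its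
    expansion is congruent to \<open>lm v\<close>.\<close>
  have "lm v - (beta_T \<beta> ^^ L) y \<in> \<int>"
    using Ints_diff[OF v(2) Ints_of_nat[of N]] by (simp add: algebra_simps)
  \<comment> \<open>For \<open>L = 0\<close> this is the choice of \<open>L\<close> itself, which
    gives \<open>y < 1\<close>; otherwise the value is a fractional part.\<close>
  moreover have "0 \<le> (beta_T \<beta> ^^ L) y \<and> (beta_T \<beta> ^^ L) y < 1"
    using y by (cases L) (simp_all add: beta_T_frac frac_lt_1)
  ultimately have TL: "(beta_T \<beta> ^^ L) y = frac (lm v)"
    using frac_unique_iff by metis
  obtain k where k: "(\<tau> ^^ k) v = 0"
    using v(1) assms by (auto simp: F_set_def)
  have zero: "(beta_T \<beta> ^^ m) y = 0" if "m \<ge> k + L" for m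
  proof -
    have "(\<tau> ^^ (m - L)) v = (\<tau> ^^ (m - L - k)) ((\<tau> ^^ k) v)"
      using that by (metis funpow_add comp_apply le_add_diff_inverse2 le_diff_conv2 add_leD2)
    then have "(\<tau> ^^ (m - L)) v = 0"
      unfolding k tau_funpow_zero .
    moreover have "(beta_T \<beta> ^^ m) y = (beta_T \<beta> ^^ (m - L)) ((beta_T \<beta> ^^ L) y)"
      using that by (metis funpow_add comp_apply le_add_diff_inverse2 add_leD2)
    ultimately show ?thesis
      unfolding TL beta_T_funpow_frac_lam by simp
  qed
  \<comment> \<open>Digit \<open>n\<close> is read off from iterate \<open>n - 1\<close>, hence the
    strict inequality.\<close>
  have "beta_digit \<beta> y n = 0" if "n > k + L" for n
    using zero[of "n - 1"] that by (simp add: beta_digit_def)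
  then have "{n. n \<ge> 1 \<and> beta_digit \<beta> y n \<noteq> 0} \<subseteq> {..k + L}"
    by (auto simp flip: not_less)
  then show "finite {n. n \<ge> 1 \<and> beta_digit \<beta> (real N / \<beta> ^ beta_L \<beta> (real N)) n \<noteq> 0}"
    unfolding y_def L_def by (rule finite_subset) simp
qed

end

theorem theorem3p3:
  fixes \<beta> :: real and d :: nat and a :: "nat \<Rightarrow> int"
  assumes "pisot \<beta>"
    and "d \<ge> 2"
    and "is_minimal_polynomial \<beta> (monom 1 d - (\<Sum>i<d. monom (of_int (a i)) i))"
    and "{l \<in> int_vecs d. tau \<beta> d a l \<in> P_set \<beta> d a} \<subseteq> P_set \<beta> d a"
    and "{l \<in> int_vecs d. \<forall>j\<in>{1..d-1}. l j \<in> {- delta \<beta> d a..delta \<beta> d a}} \<inter> V_set \<beta> d a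
           \<subseteq> F_set \<beta> d a"
  shows "property_F1 \<beta>"
proof -
  interpret pisot_shift_radix \<beta> d a
    using assms(1-3) by unfold_locales
  show ?thesis
    using V_subset_F[OF assms(4,5)] by (intro property_F1_if_V_subset_F) blast
qed

end
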